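(* Let $n\ge m\ge 2$ be integers. If $m$ is even, then $$\frac{m}{2}n+\frac{m}{2}-1\le s(K_m\,\square\, K_n)\le \frac{m}{2}n+\frac{m}{2}+1,$$ and if $m$ is odd, then $$\Big\lceil\frac{m}{2}\Big\rceil n-1\le s(K_m\,\square\, K_n)\le \Big\lceil\frac{m}{2}\Big\rceil n+1.$$
   Context: Graphs are finite and simple. $K_m$ is the complete graph on $m$ vertices, and $G\,\square\, H$ is the Cartesian product of graphs: vertex set $V(G)\times V(H)$, with $(g,h)$ adjacent to $(g',h')$ iff ($g=g'$ and $hh'\in E(H)$) or ($h=h'$ and $gg'\in E(G)$). Search number $s(G)$: Initially every edge of $G$ is dirty (may harbour an invisible intruder) and no searchers are on $G$. A search strategy is a finite sequence of actions, each being one of: place a searcher on a vertex; move a single searcher along an edge $uv$ from $u$ to $v$; remove a searcher from a vertex. An edge $uv$ is cleared when a searcher traverses it from $u$ to $v$ and either (i) immediately before the move at least two searchers are at $u$, or (ii) immediately before the move at least one searcher is at $u$ and all edges incident with $u$ other than $uv$ are already clear. The intruder moves infinitely fast along any path containing no searchers; thus after any action a clear edge is instantly recontaminated (becomes dirty) whenever an endpoint of it is joined to an endpoint of a dirty edge by a path (possibly a single vertex) none of whose vertices, including its ends, is occupied by a searcher. Recontamination is permitted during a strategy. The strategy succeeds if upon completion all edges are simultaneously clear. The search number $s(G)$ is the minimum number of searchers for which a successful search strategy exists. *)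

theory Defs
  imports Complex_Main "HOL-Library.Multiset"
begin

record 'a ugraph =
  verts :: "'a set"
  edges :: "'a set set"

definition fin_simple_graph :: "'a ugraph \<Rightarrow> bool" where
  "fin_simple_graph G \<longleftrightarrow>
     finite (verts G) \<and> (\<forall>e \<in> edges G. \<exists>u v. e = {u, v} \<and> u \<noteq> v \<and> u \<in> verts G \<and> v \<in> verts G)"

definition complete_graph :: "nat \<Rightarrow> nat ugraph" where
  "complete_graph m =
     \<lparr> verts = {..<m}, edges = {{u, v} | u v. u < m \<and> v < m \<and> u \<noteq> v} \<rparr>"

definition cart_prod :: "'a ugraph \<Rightarrow> 'b ugraph \<Rightarrow> ('a \<times> 'b) ugraph"  (infixl \<open>\<box>\<close> 70) where
  "G \<box> H =
     \<lparr> verts = verts G \<times> verts H,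
       edges = {{(g, h), (g', h')} | g h g' h'.
                  g \<in> verts G \<and> g' \<in> verts G \<and> h \<in> verts H \<and> h' \<in> verts H \<and>
                  (g = g' \<and> {h, h'} \<in> edges H \<or> h = h' \<and> {g, g'} \<in> edges G)} \<rparr>"

lemma fin_simple_complete_graph: "fin_simple_graph (complete_graph m)"
  by (auto simp: fin_simple_graph_def complete_graph_def)

lemma fin_simple_cart_prod:
  assumes "fin_simple_graph G" "fin_simple_graph H"
  shows "fin_simple_graph (G \<box> H)"
proof -
  have ne: "u \<noteq> v" if "fin_simple_graph K" "{u, v} \<in> edges K" for K :: "'c ugraph" and u v
    using that unfolding fin_simple_graph_def by (metis doubleton_eq_iff)
  have "\<exists>p q. e = {p, q} \<and> p \<noteq> q \<and> p \<in> verts G \<times> verts H \<and> q \<in> verts G \<times> verts H"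
    if "e \<in> edges (G \<box> H)" for e
  proof -
    from that obtain g h g' h' where e: "e = {(g, h), (g', h')}"
      and in_verts: "g \<in> verts G" "g' \<in> verts G" "h \<in> verts H" "h' \<in> verts H"
      and adj: "g = g' \<and> {h, h'} \<in> edges H \<or> h = h' \<and> {g, g'} \<in> edges G"
      unfolding cart_prod_def by auto
    have "(g, h) \<noteq> (g', h')"
      using adj ne[OF assms(1)] ne[OF assms(2)] by blast
    with e in_verts show ?thesis by blast
  qed
  with assms show ?thesis
    by (simp add: fin_simple_graph_def cart_prod_def)
qed

definition is_path :: "'a ugraph \<Rightarrow> 'a list \<Rightarrow> bool" where
  "is_path G xs \<longleftrightarrow>
     xs \<noteq> [] \<and> distinct xs \<and> set xs \<subseteq> verts G \<and> successively (\<lambda>u v. {u, v} \<in> edges G) xs"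

text \<open>
  Searchers are indistinguishable, so their positions form a multiset of vertices. The path
  below is free of searchers at all of its vertices, its two ends included.
\<close>

definition unguarded :: "'a ugraph \<Rightarrow> 'a multiset \<Rightarrow> 'a \<Rightarrow> 'a \<Rightarrow> bool" where
  "unguarded G P x y \<longleftrightarrow>
     (\<exists>xs. is_path G xs \<and> hd xs = x \<and> last xs = y \<and> set xs \<inter> set_mset P = {})"

text \<open>
  A state consists of the positions of the searchers and the set of clear edges; all other
  edges are dirty.
\<close>

type_synonym 'a state = "'a multiset \<times> 'a set set"

text \<open>
  One round of recontamination is enough, see \<open>recontaminate_idem\<close> below.
\<close>

definition recontaminate :: "'a ugraph \<Rightarrow> 'a multiset \<Rightarrow> 'a set set \<Rightarrow> 'a set set" where
  "recontaminate G P C =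
     {e \<in> C. \<not> (\<exists>f \<in> edges G - C. \<exists>x \<in> e. \<exists>y \<in> f. unguarded G P x y)}"

datatype 'a action = Place 'a | Move 'a 'a | Remove 'a

fun legal :: "'a ugraph \<Rightarrow> 'a state \<Rightarrow> 'a action \<Rightarrow> bool" where
  "legal G (P, C) (Place v) \<longleftrightarrow> v \<in> verts G"
| "legal G (P, C) (Move u v) \<longleftrightarrow> u \<in># P \<and> {u, v} \<in> edges G"
| "legal G (P, C) (Remove v) \<longleftrightarrow> v \<in># P"

text \<open>Here \<open>P\<close> and \<open>C\<close> describe the situation immediately before the move.\<close>

definition clears :: "'a ugraph \<Rightarrow> 'a state \<Rightarrow> 'a \<Rightarrow> 'a \<Rightarrow> bool" where
  "clears G = (\<lambda>(P, C) u v.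
     count P u \<ge> 2 \<or>
     (count P u \<ge> 1 \<and> (\<forall>e \<in> edges G. u \<in> e \<and> e \<noteq> {u, v} \<longrightarrow> e \<in> C)))"

fun perform :: "'a ugraph \<Rightarrow> 'a state \<Rightarrow> 'a action \<Rightarrow> 'a state" where
  "perform G (P, C) (Place v) =
     (let P' = P + {#v#} in (P', recontaminate G P' C))"
| "perform G (P, C) (Move u v) =
     (let P' = P - {#u#} + {#v#};
          C' = (if clears G (P, C) u v then insert {u, v} C else C)
      in (P', recontaminate G P' C'))"
| "perform G (P, C) (Remove v) =
     (let P' = P - {#v#} in (P', recontaminate G P' C))"

text \<open>
  \<open>execution G k as s\<close>: the sequence of actions \<open>as\<close>, started with all edges dirty and no
  searchers on \<open>G\<close>, leads to the state \<open>s\<close> and never has more than \<open>k\<close> searchers on \<open>G\<close> at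
  the same time. A removed searcher may be placed again later.
\<close>

inductive execution :: "'a ugraph \<Rightarrow> nat \<Rightarrow> 'a action list \<Rightarrow> 'a state \<Rightarrow> bool"
  for G :: "'a ugraph" and k :: nat where
  start: "execution G k [] ({#}, {})"
| step: "execution G k as s \<Longrightarrow> legal G s a \<Longrightarrow> size (fst (perform G s a)) \<le> k \<Longrightarrow>
           execution G k (as @ [a]) (perform G s a)"

definition searchable :: "'a ugraph \<Rightarrow> nat \<Rightarrow> bool" where
  "searchable G k \<longleftrightarrow> (\<exists>as P. execution G k as (P, edges G))"

definition search_number :: "'a ugraph \<Rightarrow> nat" where
  "search_number G = (LEAST k. searchable G k)"

lemma unguarded_iff_rtranclp:
  "unguarded G P x y \<longleftrightarrow>
     x \<in> verts G \<and> x \<notin># P \<and>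
     (\<lambda>u v. {u, v} \<in> edges G \<and> v \<in> verts G \<and> v \<notin># P)\<^sup>*\<^sup>* x y"
  (is "_ \<longleftrightarrow> _ \<and> _ \<and> ?R\<^sup>*\<^sup>* x y")
proof
  assume "unguarded G P x y"
  then obtain xs where xs: "xs \<noteq> []" "set xs \<subseteq> verts G"
      "successively (\<lambda>u v. {u, v} \<in> edges G) xs"
      "hd xs = x" "last xs = y" "set xs \<inter> set_mset P = {}"
    unfolding unguarded_def is_path_def by blast
  have "?R\<^sup>*\<^sup>* (hd xs) (last xs)"
    using xs(1,2,3,6)
  proof (induction xs rule: list_nonempty_induct)
    case (cons z zs)
    from cons.prems cons.hyps have "?R z (hd zs)"
      by (cases zs) auto
    moreover from cons.prems cons.hyps have "?R\<^sup>*\<^sup>* (hd zs) (last zs)"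
      by (intro cons.IH) (auto simp: successively_Cons)
    ultimately show ?case
      using cons.hyps by (simp add: converse_rtranclp_into_rtranclp)
  qed simp
  moreover have "hd xs \<in> set xs" using xs(1) by simp
  ultimately show "x \<in> verts G \<and> x \<notin># P \<and> ?R\<^sup>*\<^sup>* x y"
    using xs by auto
next
  assume *: "x \<in> verts G \<and> x \<notin># P \<and> ?R\<^sup>*\<^sup>* x y"
  then have "?R\<^sup>*\<^sup>* x y" by blast
  then show "unguarded G P x y"
  proof (induction rule: rtranclp_induct)
    case base
    show ?case
      unfolding unguarded_def is_path_def using * by (intro exI[of _ "[x]"]) auto
  next
    case (step y z)
    then obtain xs where xs: "is_path G xs" "hd xs = x" "last xs = y" "set xs \<inter> set_mset P = {}"
      unfolding unguarded_def by blast
    show ?case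
    proof (cases "z \<in> set xs")
      case True
      then obtain ys zs where split: "xs = ys @ z # zs"
        by (meson split_list)
      have "is_path G (ys @ [z])"
        using xs(1) unfolding is_path_def split by (auto simp: successively_append_iff)
      moreover have "hd (ys @ [z]) = x"
        using xs(2) unfolding split by (cases ys) auto
      ultimately show ?thesis
        unfolding unguarded_def using xs(4) split by (intro exI[of _ "ys @ [z]"]) auto
    next
      case False
      have "is_path G (xs @ [z])"
        using xs False step.hyps(2) unfolding is_path_def by (auto simp: successively_append_iff)
      then show ?thesis
        unfolding unguarded_def using xs step.hyps(2)
        by (intro exI[of _ "xs @ [z]"]) (auto simp: is_path_def)
    qed
  qed
qed

lemma recontaminate_idem:
  assumes "fin_simple_graph G"
  shows "recontaminate G P (recontaminate G P C) = recontaminate G P C"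
proof -
  let ?R = "\<lambda>u v. {u, v} \<in> edges G \<and> v \<in> verts G \<and> v \<notin># P"
  have "\<exists>f \<in> edges G - C. \<exists>x \<in> e. \<exists>y \<in> f. unguarded G P x y"
    if f: "f \<in> edges G - recontaminate G P C" and xy: "x \<in> e" "y \<in> f" "unguarded G P x y"
    for e f x y
  proof (cases "f \<in> C")
    case False
    with f xy show ?thesis by blast
  next
    case True
    with f obtain f' x' y' where f': "f' \<in> edges G - C" "x' \<in> f" "y' \<in> f'" "unguarded G P x' y'"
      unfolding recontaminate_def by blast
    from assms f obtain u v where "f = {u, v}"
      unfolding fin_simple_graph_def by blast
    with xy(2) f'(2) have "y = x' \<or> {y, x'} = f"
      by auto
    moreover have "x' \<in> verts G" "x' \<notin># P"
      using f'(4) unfolding unguarded_iff_rtranclp by auto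
    ultimately have "?R\<^sup>*\<^sup>* y x'"
      using f by (metis (mono_tags, lifting) DiffD1 r_into_rtranclp rtranclp.rtrancl_refl)
    then have "unguarded G P x y'"
      using xy(3) f'(4) unfolding unguarded_iff_rtranclp
      by (auto elim!: rtranclp_trans)
    with xy(1) f' show ?thesis by blast
  qed
  then have "e \<notin> recontaminate G P C"
    if "f \<in> edges G - recontaminate G P C" "x \<in> e" "y \<in> f" "unguarded G P x y" for e f x y
    using that unfolding recontaminate_def[of G P C] by blast
  then show ?thesis
    unfolding recontaminate_def[of G P "recontaminate G P C"] by blast
qed

end

theory Submission
  imports Defs
begin

text \<open>
  Put \<open>h = m div 2\<close>, and let \<open>w\<close> be \<open>h * n + h\<close> for even \<open>m\<close> and \<open>(h + 1) * n\<close> for odd \<open>m\<close>.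
  The theorem says that the search number \<open>s\<close> satisfies \<open>w \<le> s + 1\<close> and \<open>s \<le> w + 1\<close>. The
  number \<open>w\<close> is one more than both the treewidth and the pathwidth of the product, and the two
  inequalities come from the two sides of that fact: a bramble that cannot be covered by fewer
  than \<open>w\<close> vertices, and a path decomposition with bags of at most \<open>w\<close> vertices.

  Lower bound (\<open>bramble_imp_not_searchable\<close>). In a bramble, every member is connected and any two
  members meet a common edge. If no \<open>k + 1\<close> vertices cover it, then \<open>k\<close> searchers never clear
  all the edges at any member. A change for the better could only come from a move from \<open>u\<close> to
  \<open>v\<close>, and some member \<open>b\<close> contains neither \<open>u\<close> nor a guarded vertex. An edge at \<open>b\<close> is still dirty;
  being connected and unguarded, \<open>b\<close> is contaminated throughout, and it shares an edge with
  every other member. The argument does not ask how an edge was cleared and holds for strategies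
  with recontamination.

  The bramble of the product consists of the connected sets that meet more than half of the rows,
  with ties broken by the number of columns, and then by one fixed row. Two such sets share a row
  or a column. If few cells are deleted, then on average almost half of a column survives, and
  \<open>rook_bramble_avoids\<close> assembles a large connected set from whole surviving columns.

  Upper bound (\<open>interval_representation_searchable\<close>). Given an interval for each vertex, such that
  adjacent vertices have intersecting intervals and no point lies in more than \<open>w\<close> intervals,
  a team of \<open>w + 1\<close> sweeps over the points: one searcher stands on each vertex whose
  interval contains the current point, and the spare one clears the edges between them. For the
  product, sweep over the columns: the cells of the first \<open>h\<close> rows are guarded until their column
  is reached, those of the last \<open>h\<close> rows from then on. If \<open>m\<close> is odd, the middle row starts in
  the second mode and is switched to the first when \<open>h\<close> columns are done; switching at
  this moment keeps the number of guards down to \<open>(h + 1) * n\<close>.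
\<close>

section \<open>Brambles defeat searchers\<close>

definition connected_on :: "'a ugraph \<Rightarrow> 'a set \<Rightarrow> bool" where
  "connected_on G b \<longleftrightarrow> (\<forall>x\<in>b. \<forall>y\<in>b. (\<lambda>u v. {u, v} \<in> edges G \<and> v \<in> b)\<^sup>*\<^sup>* x y)"

text \<open>
  In a graph without isolated vertices, two sets meet a common edge iff they share a vertex or are
  joined by an edge. Taking \<open>b = b'\<close> shows that every member is nonempty and meets an edge.
\<close>

definition bramble :: "'a ugraph \<Rightarrow> 'a set set \<Rightarrow> bool" where
  "bramble G B \<longleftrightarrow>
     (\<forall>b\<in>B. b \<subseteq> verts G \<and> connected_on G b) \<and>
     (\<forall>b\<in>B. \<forall>b'\<in>B. \<exists>e\<in>edges G. e \<inter> b \<noteq> {} \<and> e \<inter> b' \<noteq> {})"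

lemma connected_on_imp_unguarded:
  assumes "connected_on G b" "b \<subseteq> verts G" "b \<inter> set_mset P = {}" "x \<in> b" "y \<in> b"
  shows "unguarded G P x y"
proof -
  have "(\<lambda>u v. {u, v} \<in> edges G \<and> v \<in> b)\<^sup>*\<^sup>* x y"
    using assms unfolding connected_on_def by blast
  then have "(\<lambda>u v. {u, v} \<in> edges G \<and> v \<in> verts G \<and> v \<notin># P)\<^sup>*\<^sup>* x y"
    by (rule rtranclp_mono[THEN predicate2D, rotated]) (use assms(2,3) in blast)
  then show ?thesis
    using assms unfolding unguarded_iff_rtranclp by blast
qed

text \<open>
  The invariant of the lower bound. Recontamination only helps it, so only a move can threaten it,
  and then there is a member \<open>b0\<close> off the guards and off the edge being traversed to spread the
  contamination.
\<close>

lemma bramble_keeps_dirty_edges: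
  assumes B: "bramble G B"
    and avoid: "\<And>W. finite W \<Longrightarrow> card W \<le> Suc k \<Longrightarrow> \<exists>b\<in>B. b \<inter> W = {}"
    and "execution G k as s" "b \<in> B"
  shows "\<exists>e\<in>edges G - snd s. e \<inter> b \<noteq> {}"
  using assms(3,4)
proof (induction arbitrary: b rule: execution.induct)
  case start
  then show ?case using B unfolding bramble_def by fastforce
next
  case (step as s a b)
  obtain P C where s: "s = (P, C)" by (cases s)
  have keep: ?case if "snd (perform G s a) \<subseteq> C"
    using step.IH[OF step.prems] that by (auto simp: s)
  show ?case
  proof (cases a)
    case (Place v)
    then show ?thesis by (intro keep) (auto simp: s Let_def recontaminate_def)
  next
    case (Remove v)
    then show ?thesis by (intro keep) (auto simp: s Let_def recontaminate_def)
  next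
    case (Move u v)
    define P' where "P' = P - {#u#} + {#v#}"
    define C' where "C' = (if clears G (P, C) u v then insert {u, v} C else C)"
    have after: "perform G s a = (P', recontaminate G P' C')"
      by (simp add: s Move P'_def C'_def Let_def)
    \<comment> \<open>The vertex \<open>u\<close> left behind has to be avoided as well: this is where \<open>k + 1\<close> comes from.\<close>
    have "card (insert u (set_mset P')) \<le> Suc (card (set_mset P'))"
      by (simp add: card_insert_if)
    also have "card (set_mset P') \<le> size P'"
      using size_multiset_overloaded_eq[of P'] sum_mono[of "set_mset P'" "\<lambda>_. 1" "count P'"]
      by (simp add: Suc_le_eq)
    also have "size P' \<le> k"
      using step.hyps(3) by (simp add: after)
    finally obtain b0 where b0: "b0 \<in> B" "b0 \<inter> insert u (set_mset P') = {}"
      using avoid[of "insert u (set_mset P')"] by auto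
    obtain f y where f: "f \<in> edges G - C" "y \<in> f" "y \<in> b0"
      using step.IH[OF b0(1)] by (auto simp: s)
    have "v \<notin> b0" "u \<notin> b0"
      using b0(2) by (auto simp: P'_def)
    with f have f': "f \<in> edges G - C'"
      by (auto simp: C'_def)
    obtain e x where e: "e \<in> edges G" "x \<in> e" "x \<in> b0" "e \<inter> b \<noteq> {}"
    proof -
      have "\<exists>e\<in>edges G. e \<inter> b0 \<noteq> {} \<and> e \<inter> b \<noteq> {}"
        using B b0(1) step.prems unfolding bramble_def by simp
      then show thesis using that by blast
    qed
    have "unguarded G P' x y"
      using B b0 e(3) f(3) by (intro connected_on_imp_unguarded) (auto simp: bramble_def)
    with e f f' have "e \<in> edges G - recontaminate G P' C'"
      unfolding recontaminate_def by blast
    with e(4) show ?thesis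
      by (auto simp: after)
  qed
qed

lemma bramble_imp_not_searchable:
  assumes "bramble G B"
    and avoid: "\<And>W. finite W \<Longrightarrow> card W \<le> Suc k \<Longrightarrow> \<exists>b\<in>B. b \<inter> W = {}"
  shows "\<not> searchable G k"
proof
  assume "searchable G k"
  then obtain as P where "execution G k as (P, edges G)"
    unfolding searchable_def by blast
  moreover obtain b where "b \<in> B"
    using avoid[of "{}"] by auto
  ultimately show False
    using bramble_keeps_dirty_edges[OF assms] by fastforce
qed

section \<open>A bramble of the rook's graph\<close>

abbreviation rook :: "nat \<Rightarrow> nat \<Rightarrow> (nat \<times> nat) ugraph" where
  "rook m n \<equiv> complete_graph m \<box> complete_graph n"

lemma verts_rook: "verts (rook m n) = {..<m} \<times> {..<n}"
  by (simp add: cart_prod_def complete_graph_def)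

lemma rook_adjacent_iff:
  "{(i, j), (i', j')} \<in> edges (rook m n) \<longleftrightarrow>
     i < m \<and> i' < m \<and> j < n \<and> j' < n \<and> (i = i' \<and> j \<noteq> j' \<or> j = j' \<and> i \<noteq> i')"
  (is "?e \<in> _ \<longleftrightarrow> ?R")
proof
  assume "?e \<in> edges (rook m n)"
  then show ?R
    by (auto simp: cart_prod_def complete_graph_def doubleton_eq_iff)
next
  assume ?R
  moreover have "verts (complete_graph k) = {..<k}" for k
    by (simp add: complete_graph_def)
  moreover have "{u, v} \<in> edges (complete_graph k) \<longleftrightarrow> u < k \<and> v < k \<and> u \<noteq> v" for u v k
    by (auto simp: complete_graph_def doubleton_eq_iff)
  ultimately show "?e \<in> edges (rook m n)"
    unfolding cart_prod_def
    by simp (rule exI[of _ i], rule exI[of _ j], rule exI[of _ i'], rule exI[of _ j'], simp)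
qed

text \<open>
  For even \<open>m\<close>, two sets with exactly half of the rows need not share a row. Then the columns have
  to decide, and if these are split evenly too, any fixed row can: row \<open>0\<close> is an arbitrary choice.
\<close>

definition rook_bramble :: "nat \<Rightarrow> nat \<Rightarrow> (nat \<times> nat) set set" where
  "rook_bramble m n =
     {b. b \<subseteq> verts (rook m n) \<and> connected_on (rook m n) b \<and>
         (m < 2 * card (fst ` b) \<or>
          m = 2 * card (fst ` b) \<and>
            (n < 2 * card (snd ` b) \<or> n = 2 * card (snd ` b) \<and> 0 \<in> fst ` b))}"

lemma Int_nonempty_if_large:
  assumes "A \<subseteq> {..<k}" "B \<subseteq> {..<k}" "k < card A + card B"
  shows "A \<inter> B \<noteq> {}"
proof
  assume "A \<inter> B = {}"
  then have "card (A \<union> B) = card A + card B"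
    using assms(1,2) by (intro card_Un_disjoint) (auto intro: finite_subset)
  moreover have "card (A \<union> B) \<le> k"
    using card_mono[of "{..<k}" "A \<union> B"] assms by simp
  ultimately show False using assms(3) by simp
qed

lemma bramble_rook:
  assumes "2 \<le> m" "2 \<le> n"
  shows "bramble (rook m n) (rook_bramble m n)"
proof -
  have "\<exists>e\<in>edges (rook m n). e \<inter> b \<noteq> {} \<and> e \<inter> b' \<noteq> {}"
    if b: "b \<in> rook_bramble m n" and b': "b' \<in> rook_bramble m n" for b b'
  proof -
    have sub: "b \<subseteq> {..<m} \<times> {..<n}" "b' \<subseteq> {..<m} \<times> {..<n}"
      using b b' by (auto simp: rook_bramble_def verts_rook)
    have rows: "fst ` b \<subseteq> {..<m}" "fst ` b' \<subseteq> {..<m}"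
      and cols: "snd ` b \<subseteq> {..<n}" "snd ` b' \<subseteq> {..<n}"
      using sub by auto
    have "m < card (fst ` b) + card (fst ` b') \<or> n < card (snd ` b) + card (snd ` b') \<or>
          0 \<in> fst ` b \<inter> fst ` b'"
      using b b' unfolding rook_bramble_def mem_Collect_eq Int_iff
      by (elim conjE disjE) linarith+
    then have "fst ` b \<inter> fst ` b' \<noteq> {} \<or> snd ` b \<inter> snd ` b' \<noteq> {}"
      using Int_nonempty_if_large[OF rows] Int_nonempty_if_large[OF cols] by blast
    then show ?thesis
    proof
      assume "fst ` b \<inter> fst ` b' \<noteq> {}"
      then obtain i j j' where ij: "(i, j) \<in> b" "(i, j') \<in> b'" by force
      have "i < m" "j < n" "j' < n" using ij sub by auto
      \<comment> \<open>If \<open>b\<close> and \<open>b'\<close> share the cell itself, any other cell of its row gives the edge.\<close>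
      define l where "l = (if j \<noteq> j' then j' else if j = 0 then 1 else 0)"
      have "l < n" "l \<noteq> j" using \<open>j' < n\<close> assms by (auto simp: l_def)
      with \<open>i < m\<close> \<open>j < n\<close> have "{(i, j), (i, l)} \<in> edges (rook m n)"
        by (simp add: rook_adjacent_iff)
      moreover have "(i, j) \<in> b' \<or> (i, l) \<in> b'" using ij by (auto simp: l_def)
      ultimately show ?thesis using ij(1) by (intro bexI[of _ "{(i, j), (i, l)}"]) auto
    next
      assume "snd ` b \<inter> snd ` b' \<noteq> {}"
      then obtain i i' j where ij: "(i, j) \<in> b" "(i', j) \<in> b'" by force
      have "i < m" "i' < m" "j < n" using ij sub by auto
      define l where "l = (if i \<noteq> i' then i' else if i = 0 then 1 else 0)"
      have "l < m" "l \<noteq> i" using \<open>i' < m\<close> assms by (auto simp: l_def)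
      with \<open>i < m\<close> \<open>j < n\<close> have "{(i, j), (l, j)} \<in> edges (rook m n)"
        by (simp add: rook_adjacent_iff)
      moreover have "(i, j) \<in> b' \<or> (l, j) \<in> b'" using ij by (auto simp: l_def)
      ultimately show ?thesis using ij(1) by (intro bexI[of _ "{(i, j), (l, j)}"]) auto
    qed
  qed
  then show ?thesis
    by (auto simp: bramble_def rook_bramble_def)
qed

text \<open>
  Sets of cells are described column by column, because the counting argument and the walks that
  show connectedness both go through the columns.
\<close>

definition cells :: "(nat \<Rightarrow> nat set) \<Rightarrow> nat set \<Rightarrow> (nat \<times> nat) set" where
  "cells F T = {(i, j). j \<in> T \<and> i \<in> F j}"

lemma card_cells:
  assumes "finite T" "\<And>j. j \<in> T \<Longrightarrow> finite (F j)"
  shows "card (cells F T) = (\<Sum>j\<in>T. card (F j))"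
proof -
  have "cells F T = prod.swap ` (SIGMA j:T. F j)"
    by (force simp: cells_def)
  then show ?thesis
    using assms by (simp add: card_image)
qed

lemma fst_cells: "fst ` cells F T = (\<Union>j\<in>T. F j)"
  by (force simp: cells_def)

lemma snd_cells: "(\<And>j. j \<in> T \<Longrightarrow> F j \<noteq> {}) \<Longrightarrow> snd ` cells F T = T"
  by (force simp: cells_def)

text \<open>From any column one can change to column \<open>c\<close> along a common row, and columns are cliques.\<close>

lemma connected_on_cells:
  assumes sub: "cells F T \<subseteq> verts (rook m n)" and "c \<in> T"
    and meet: "\<And>j. j \<in> T \<Longrightarrow> F j \<inter> F c \<noteq> {}"
  shows "connected_on (rook m n) (cells F T)"
proof -
  let ?R = "(\<lambda>u v. {u, v} \<in> edges (rook m n) \<and> v \<in> cells F T)\<^sup>*\<^sup>*"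
  have col: "?R (i, j) (i', j)" if "j \<in> T" "i \<in> F j" "i' \<in> F j" for i i' j
  proof -
    have "(i, j) \<in> cells F T" "(i', j) \<in> cells F T" using that by (auto simp: cells_def)
    with sub show ?thesis
      by (cases "i = i'") (auto simp: rook_adjacent_iff verts_rook intro!: r_into_rtranclp)
  qed
  have row: "?R (i, j) (i, j')" if "j \<in> T" "j' \<in> T" "i \<in> F j" "i \<in> F j'" for i j j'
  proof -
    have "(i, j) \<in> cells F T" "(i, j') \<in> cells F T" using that by (auto simp: cells_def)
    with sub show ?thesis
      by (cases "j = j'") (auto simp: rook_adjacent_iff verts_rook intro!: r_into_rtranclp)
  qed
  have walk: "?R (i, j) (i', j')" if ij: "j \<in> T" "i \<in> F j" "j' \<in> T" "i' \<in> F j'" for i i' j j'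
  proof -
    obtain a a' where a: "a \<in> F j" "a \<in> F c" and a': "a' \<in> F j'" "a' \<in> F c"
      using meet[OF ij(1)] meet[OF ij(3)] by blast
    have 1: "?R (i, j) (a, j)" by (rule col[OF ij(1,2) a(1)])
    have 2: "?R (a, j) (a, c)" by (rule row[OF ij(1) \<open>c \<in> T\<close> a])
    have 3: "?R (a, c) (a', c)" by (rule col[OF \<open>c \<in> T\<close> a(2) a'(2)])
    have 4: "?R (a', c) (a', j')" by (rule row[OF \<open>c \<in> T\<close> ij(3) a'(2,1)])
    have 5: "?R (a', j') (i', j')" by (rule col[OF ij(3) a'(1) ij(4)])
    show ?thesis
      by (rule 1[THEN rtranclp_trans, OF 2[THEN rtranclp_trans, OF
            3[THEN rtranclp_trans, OF 4[THEN rtranclp_trans, OF 5]]]])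
  qed
  show ?thesis
    unfolding connected_on_def
  proof (intro ballI)
    fix x y assume xy: "x \<in> cells F T" "y \<in> cells F T"
    obtain i j where x: "x = (i, j)" by (cases x)
    obtain i' j' where y: "y = (i', j')" by (cases y)
    have "j \<in> T" "i \<in> F j" "j' \<in> T" "i' \<in> F j'"
      using xy by (simp_all add: x y cells_def)
    then show "?R x y" unfolding x y by (rule walk)
  qed
qed

text \<open>
  One more than the treewidth and the pathwidth: no fewer cells cover the bramble, and no more
  guards are needed in the sweep of the upper bound.
\<close>

definition rook_width :: "nat \<Rightarrow> nat \<Rightarrow> nat" where
  "rook_width m n = (if even m then m div 2 * n + m div 2 else Suc (m div 2) * n)"

text \<open>
  If some column keeps more than \<open>m div 2\<close> cells, these cells form a member of the bramble. By
  counting, that is the case if \<open>m\<close> is odd. For even \<open>m\<close>, suppose that it is not. The columns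
  fall short of \<open>m div 2\<close> cells by less than \<open>m div 2\<close> in total, hence none is empty and any
  \<open>m div 2\<close> columns contain one with exactly \<open>m div 2\<close> cells. Fix such a column \<open>c\<close>. A column that
  meets the rows of \<open>c\<close> without being contained in them yields, together with \<open>c\<close>, a connected
  set with too many rows. Otherwise every column is contained in the rows of \<open>c\<close> or disjoint from
  them. Those of the first kind form a connected set, which will do if they are the majority. If
  they are not, the others number at least \<open>n / 2 \<ge> m div 2\<close>, so one of them has exactly the rows
  complementary to \<open>c\<close> and connects them all; now one of the two sets wins the tie.
\<close>

lemma rook_bramble_avoids:
  assumes "2 \<le> m" "m \<le> n" "finite W"
    and small: "card W < rook_width m n"
  shows "\<exists>b\<in>rook_bramble m n. b \<inter> W = {}"
proof -
  define h where "h = m div 2"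
  define F where "F j = {i. i < m \<and> (i, j) \<notin> W}" for j
  have fin [simp]: "finite (F j)" for j by (simp add: F_def)
  have avoid: "cells F T \<inter> W = {}" for T by (auto simp: F_def cells_def)
  have sub: "cells F T \<subseteq> verts (rook m n)" if "T \<subseteq> {..<n}" for T
    using that by (auto simp: F_def cells_def verts_rook)
  have found: ?thesis
    if "c \<in> T" "T \<subseteq> {..<n}" "\<And>j. j \<in> T \<Longrightarrow> F j \<inter> F c \<noteq> {}"
      "m < 2 * card (\<Union>j\<in>T. F j) \<or>
       m = 2 * card (\<Union>j\<in>T. F j) \<and> (n < 2 * card T \<or> n = 2 * card T \<and> 0 \<in> (\<Union>j\<in>T. F j))"
    for c T
  proof -
    have "snd ` cells F T = T" using that(3) by (intro snd_cells) auto
    then have "cells F T \<in> rook_bramble m n"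
      using sub[OF that(2)] connected_on_cells[OF sub[OF that(2)] that(1,3)] that(4)
      unfolding rook_bramble_def by (auto simp: fst_cells)
    with avoid show ?thesis by blast
  qed
  have "m * n = card ({..<m} \<times> {..<n})" by simp
  also have "\<dots> \<le> card (cells F {..<n} \<union> W)"
    using finite_subset[OF sub[of "{..<n}"]] \<open>finite W\<close>
    by (intro card_mono) (auto simp: cells_def F_def verts_rook)
  also have "\<dots> \<le> card (cells F {..<n}) + card W" by (rule card_Un_le)
  also have "card (cells F {..<n}) = (\<Sum>j<n. card (F j))" by (rule card_cells) auto
  finally have total: "m * n \<le> (\<Sum>j<n. card (F j)) + card W" .
  show ?thesis
  proof (cases "\<exists>j<n. h < card (F j)")
    case True
    then obtain j where j: "j < n" "h < card (F j)" by blast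
    then have "F j \<noteq> {}" by auto
    with j show ?thesis
      by (intro found[of j "{j}"]) (auto simp: h_def)
  next
    case False
    then have le: "card (F j) \<le> h" if "j < n" for j using that by force
    have bound: "(\<Sum>j<n. card (F j)) \<le> h * n"
      using sum_bounded_above[of "{..<n}" "\<lambda>j. card (F j)" h] le by (simp add: mult.commute)
    have "even m"
    proof (rule ccontr)
      assume "odd m"
      then have "m = h + Suc h" by (auto simp: h_def elim!: oddE)
      then have "m * n = h * n + Suc h * n" by (simp add: algebra_simps)
      with total bound small \<open>odd m\<close> show False by (simp add: h_def rook_width_def)
    qed
    then have m: "m = 2 * h" by (simp add: h_def)
    define d where "d j = h - card (F j)" for j
    have "(\<Sum>j<n. card (F j)) + (\<Sum>j<n. d j) = (\<Sum>j<n. h)"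
      unfolding sum.distrib[symmetric] by (intro sum.cong) (auto simp: d_def le)
    with total small have deficit: "(\<Sum>j<n. d j) < h"
      by (simp add: m rook_width_def algebra_simps)
    have full: "\<exists>j\<in>T. card (F j) = h" if "T \<subseteq> {..<n}" "h \<le> card T" for T
    proof (rule ccontr)
      assume *: "\<not> ?thesis"
      have "1 \<le> d j" if "j \<in> T" for j
        using * le[of j] \<open>T \<subseteq> {..<n}\<close> that by (force simp: d_def)
      then have "card T \<le> (\<Sum>j\<in>T. d j)"
        using sum_mono[of T "\<lambda>_. 1" d] by simp
      also have "\<dots> \<le> (\<Sum>j<n. d j)" using that(1) by (intro sum_mono2) auto
      finally show False using deficit that(2) by simp
    qed
    have ne: "F j \<noteq> {}" if "j < n" for j
    proof
      assume "F j = {}"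
      then have "h = (\<Sum>j\<in>{j}. d j)" by (simp add: d_def)
      also have "\<dots> \<le> (\<Sum>j<n. d j)" using that by (intro sum_mono2) auto
      finally show False using deficit by simp
    qed
    obtain c where c: "c < n" "card (F c) = h"
      using full[of "{..<n}"] assms(1,2) m by auto
    show ?thesis
    proof (cases "\<exists>j<n. F j \<inter> F c \<noteq> {} \<and> \<not> F j \<subseteq> F c")
      case True
      then obtain j where j: "j < n" "F j \<inter> F c \<noteq> {}" "\<not> F j \<subseteq> F c" by blast
      have "card (F c) < card (F j \<union> F c)"
        using j(3) by (intro psubset_card_mono) auto
      then show ?thesis
        using j c ne[OF c(1)] by (intro found[of c "{j, c}"]) (auto simp: m)
    next
      case False
      define T where "T = {j. j < n \<and> F j \<subseteq> F c}"
      define T' where "T' = {j. j < n \<and> F j \<inter> F c = {}}"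
      have sub_T: "T \<subseteq> {..<n}" "T' \<subseteq> {..<n}" by (auto simp: T_def T'_def)
      have "T \<union> T' = {..<n}" using False by (auto simp: T_def T'_def)
      moreover have "T \<inter> T' = {}" using ne by (auto simp: T_def T'_def)
      ultimately have card_T: "card T + card T' = n"
        using card_Un_disjoint[of T T'] sub_T by (metis card_lessThan finite_lessThan finite_subset)
      have UT: "(\<Union>j\<in>T. F j) = F c" and cT: "c \<in> T" using c by (auto simp: T_def)
      have meet_T: "F j \<inter> F c \<noteq> {}" if "j \<in> T" for j
        using ne[of j] that by (auto simp: T_def)
      show ?thesis
      proof (cases "n < 2 * card T \<or> n = 2 * card T \<and> 0 \<in> F c")
        case True
        then show ?thesis
          using c UT by (intro found[OF cT sub_T(1) meet_T]) (auto simp: m)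
      next
        case False
        then have "h \<le> card T'" using card_T assms(2) m by auto
        then obtain c' where c': "c' \<in> T'" "card (F c') = h"
          using full[OF sub_T(2)] by blast
        \<comment> \<open>Both sets have exactly half of the rows, so \<open>c\<close> and \<open>c'\<close> are complementary.\<close>
        have eq: "F c' = {..<m} - F c"
        proof (rule card_subset_eq)
          show "F c' \<subseteq> {..<m} - F c" using c'(1) by (auto simp: T'_def F_def)
          have "card ({..<m} - F c) = m - h"
            using c(2) by (subst card_Diff_subset) (auto simp: F_def)
          then show "card (F c') = card ({..<m} - F c)" using c'(2) m by simp
        qed simp
        have sub_c': "F j \<subseteq> F c'" if "j \<in> T'" for j
          unfolding eq using that by (auto simp: T'_def F_def)
        have UT': "(\<Union>j\<in>T'. F j) = F c'" using sub_c' c'(1) by blast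
        have meet_T': "F j \<inter> F c' \<noteq> {}" if "j \<in> T'" for j
          using ne[of j] sub_c'[OF that] that by (auto simp: T'_def)
        have "n < 2 * card T' \<or> n = 2 * card T' \<and> 0 \<in> F c'"
          using False card_T assms(1) by (auto simp: eq)
        then show ?thesis
          using c' UT' by (intro found[OF c'(1) sub_T(2) meet_T']) (auto simp: m)
      qed
    qed
  qed
qed

section \<open>Searching along an interval representation\<close>

definition reachable :: "'a ugraph \<Rightarrow> nat \<Rightarrow> 'a state \<Rightarrow> bool" where
  "reachable G k s \<longleftrightarrow> (\<exists>as. execution G k as s)"

text \<open>The vertices that have to be guarded to prevent recontamination.\<close>

definition frontier :: "'a ugraph \<Rightarrow> 'a set set \<Rightarrow> 'a set" where
  "frontier G C = {x. (\<exists>e\<in>C. x \<in> e) \<and> (\<exists>f\<in>edges G - C. x \<in> f)}"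

text \<open>
  At an unguarded vertex, the edges are all clear or all dirty, and which of the two is the case
  passes on from neighbour to neighbour along a path without searchers.
\<close>

lemma recontaminate_guarded:
  assumes "frontier G C \<subseteq> set_mset P"
  shows "recontaminate G P C = C"
proof -
  have False
    if e: "e \<in> C" "x \<in> e" and f: "f \<in> edges G - C" "y \<in> f" and xy: "unguarded G P x y" for e f x y
  proof -
    have "(\<lambda>u v. {u, v} \<in> edges G \<and> v \<in> verts G \<and> v \<notin># P)\<^sup>*\<^sup>* x y" and "x \<notin># P"
      using xy unfolding unguarded_iff_rtranclp by auto
    then have "y \<notin># P \<and> (\<exists>e\<in>C. y \<in> e)"
    proof (induction rule: rtranclp_induct)
      case base
      then show ?case using e by blast
    next
      case (step y z)
      then have "{y, z} \<in> C"
        using assms unfolding frontier_def by blast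
      with step show ?case by blast
    qed
    with f assms show False unfolding frontier_def by blast
  qed
  then show ?thesis unfolding recontaminate_def by blast
qed

lemma reachable_step:
  assumes "reachable G k s" "legal G s a" "size (fst (perform G s a)) \<le> k"
  shows "reachable G k (perform G s a)"
  using assms execution.step unfolding reachable_def by blast

lemma reachable_place:
  assumes "reachable G k (P, C)" "frontier G C \<subseteq> set_mset P" "v \<in> verts G" "size P < k"
  shows "reachable G k (add_mset v P, C)"
proof -
  have "recontaminate G (add_mset v P) C = C"
    using assms(2) by (intro recontaminate_guarded) auto
  with reachable_step[OF assms(1), of "Place v"] assms(3,4) show ?thesis
    by (simp add: Let_def)
qed

lemma reachable_remove:
  assumes "reachable G k (add_mset v P, C)" "frontier G C \<subseteq> set_mset P" "size P \<le> k"
  shows "reachable G k (P, C)"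
  using reachable_step[OF assms(1), of "Remove v"] assms(2-) recontaminate_guarded[of G C P]
  by (auto simp: Let_def)

text \<open>
  A spare searcher is put on \<open>u\<close> next to the guard, slides along the edge and leaves at \<open>v\<close>. The
  edge is cleared because there are two searchers on \<open>u\<close>, whatever the state of the other edges.
\<close>

lemma reachable_clear_edge:
  assumes reach: "reachable G k (P, C)" and guard: "frontier G C \<subseteq> set_mset P" and "size P < k"
    and e: "{u, v} \<in> edges G" "u \<in> verts G" "u \<in># P" "v \<in># P"
  shows "reachable G k (P, insert {u, v} C)"
proof -
  have guard': "frontier G (insert {u, v} C) \<subseteq> set_mset P"
    using guard e(3,4) by (auto simp: frontier_def)
  have "reachable G k (add_mset u P, C)"
    using assms by (intro reachable_place) auto
  then have "reachable G k (perform G (add_mset u P, C) (Move u v))"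
    using assms by (intro reachable_step) (auto simp: Let_def)
  moreover have "perform G (add_mset u P, C) (Move u v) = (add_mset v P, insert {u, v} C)"
    using e(3) guard' recontaminate_guarded[of G "insert {u, v} C" "add_mset v P"]
    by (auto simp: Let_def clears_def Suc_le_eq)
  ultimately show ?thesis
    using guard' assms(3) by (intro reachable_remove[of G k v P]) auto
qed

lemma reachable_clear_edges:
  assumes G: "fin_simple_graph G"
    and reach: "reachable G k (P, C)" and guard: "frontier G C \<subseteq> set_mset P" and "size P < k"
    and D: "finite D" "D \<subseteq> edges G" "\<Union>D \<subseteq> set_mset P"
  shows "reachable G k (P, C \<union> D)"
  using D
proof (induction rule: finite_induct)
  case empty
  show ?case using reach by simp
next
  case (insert e D)
  obtain u v where e: "e = {u, v}" "u \<in> verts G"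
    using G insert.prems unfolding fin_simple_graph_def by blast
  have "frontier G (C \<union> D) \<subseteq> frontier G C \<union> \<Union>D"
    unfolding frontier_def by blast
  also have "\<dots> \<subseteq> set_mset P"
    using guard insert.prems by simp
  finally have "frontier G (C \<union> D) \<subseteq> set_mset P" .
  then show ?case
    using reachable_clear_edge[of G k P "C \<union> D" u v] insert e \<open>size P < k\<close> by auto
qed

lemma reachable_place_set:
  assumes reach: "reachable G k (mset_set A, C)" and guard: "frontier G C \<subseteq> A"
    and "finite A" "finite D" "D \<subseteq> verts G" "A \<inter> D = {}" "card (A \<union> D) \<le> k"
  shows "reachable G k (mset_set (A \<union> D), C)"
  using assms(4-)
proof (induction rule: finite_induct)
  case empty
  show ?case using reach by simp
next
  case (insert v D)
  then have v: "v \<notin> A \<union> D" and fin: "finite (A \<union> D)" using \<open>finite A\<close> by auto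
  have "reachable G k (add_mset v (mset_set (A \<union> D)), C)"
    using insert v fin guard by (intro reachable_place) auto
  with v fin show ?case by simp
qed

lemma reachable_remove_set:
  assumes reach: "reachable G k (mset_set (A \<union> D), C)" and guard: "frontier G C \<subseteq> A"
    and "finite A" "finite D" "A \<inter> D = {}" "card (A \<union> D) \<le> k"
  shows "reachable G k (mset_set A, C)"
  using assms(4,1,5,6)
proof (induction rule: finite_induct)
  case empty
  then show ?case by simp
next
  case (insert v D)
  then have v: "v \<notin> A \<union> D" and fin: "finite (A \<union> D)" using \<open>finite A\<close> by auto
  have "card (A \<union> D) \<le> k" using insert.prems(3) v fin by simp
  moreover have "frontier G C \<subseteq> set_mset (mset_set (A \<union> D))" using guard fin by auto
  ultimately have "reachable G k (mset_set (A \<union> D), C)"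
    using insert.prems(1) v fin by (intro reachable_remove[of G k v "mset_set (A \<union> D)"]) simp_all
  then show ?case
    using insert.IH insert.prems(2) \<open>card (A \<union> D) \<le> k\<close> by simp
qed

text \<open>
  After point \<open>t\<close>, an edge is clear iff the intervals of both its ends have started. A vertex
  with a clear and a dirty edge has a neighbour whose interval starts later, so its own interval
  contains both \<open>t\<close> and \<open>t + 1\<close>: the vertices guarded at both points protect the clear edges
  while the others are exchanged. The searcher beyond the width does the clearing.
\<close>

lemma interval_representation_searchable:
  fixes lo hi :: "'a \<Rightarrow> nat"
  assumes G: "fin_simple_graph G"
    and interval: "\<And>v. v \<in> verts G \<Longrightarrow> lo v \<le> hi v"
    and overlap: "\<And>u v. {u, v} \<in> edges G \<Longrightarrow> lo u \<le> hi v"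
    and width: "\<And>t. card {v \<in> verts G. lo v \<le> t \<and> t \<le> hi v} \<le> w"
  shows "searchable G (Suc w)"
proof -
  define bag where "bag t = {v \<in> verts G. lo v \<le> t \<and> t \<le> hi v}" for t
  define cleared where "cleared t = {e \<in> edges G. \<forall>v\<in>e. lo v \<le> t}" for t
  have fin: "finite (verts G)" using G by (simp add: fin_simple_graph_def)
  have edge: "\<exists>u v. e = {u, v} \<and> u \<in> verts G \<and> v \<in> verts G" if "e \<in> edges G" for e
    using G that unfolding fin_simple_graph_def by blast
  have fin_edges: "finite (edges G)"
    by (rule finite_subset[of _ "Pow (verts G)"]) (use edge fin in auto)
  have [simp]: "finite (bag t)" for t using fin by (simp add: bag_def)
  have bag_verts: "bag t \<subseteq> verts G" for t by (auto simp: bag_def)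
  have card_bag: "card (bag t) \<le> Suc w" for t using width[of t] by (simp add: bag_def)
  have later: "lo v \<le> hi u" if e: "e \<in> edges G" "u \<in> e" "v \<in> e" for e u v
  proof -
    obtain a b where "e = {a, b}" "a \<in> verts G" "b \<in> verts G" using edge[OF e(1)] by blast
    with e overlap[of a b] overlap[of b a] interval show ?thesis
      by (auto simp: insert_commute)
  qed
  have frontier_bag: "frontier G (cleared t) \<subseteq> bag t \<inter> bag (Suc t)" for t
  proof
    fix x assume "x \<in> frontier G (cleared t)"
    then obtain e f where e: "e \<in> edges G" "x \<in> e" "lo x \<le> t"
      and f: "f \<in> edges G" "x \<in> f" "f \<notin> cleared t"
      unfolding frontier_def cleared_def by blast
    then obtain y where "y \<in> f" "t < lo y" by (auto simp: cleared_def not_le)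
    then have "t < hi x" using later[OF f(1,2)] by fastforce
    moreover have "x \<in> verts G" using edge[OF e(1)] e(2) by auto
    ultimately show "x \<in> bag t \<inter> bag (Suc t)" using e(3) by (auto simp: bag_def)
  qed
  have clear: "reachable G (Suc w) (mset_set (bag t), cleared t)"
    if "reachable G (Suc w) (mset_set (bag t), C)" "frontier G C \<subseteq> bag t"
      "C \<subseteq> cleared t" "\<And>e. e \<in> cleared t - C \<Longrightarrow> e \<subseteq> bag t" for t C
  proof -
    have "card (bag t) < Suc w" using width[of t] by (simp add: bag_def)
    moreover have "finite (cleared t - C)" "cleared t - C \<subseteq> edges G"
      using fin_edges by (auto simp: cleared_def)
    moreover have "\<Union>(cleared t - C) \<subseteq> bag t" using that(4) by blast
    ultimately have "reachable G (Suc w) (mset_set (bag t), C \<union> (cleared t - C))"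
      using that(1,2) by (intro reachable_clear_edges[OF G]) simp_all
    also have "C \<union> (cleared t - C) = cleared t" using that(3) by blast
    finally show ?thesis .
  qed
  have main: "reachable G (Suc w) (mset_set (bag t), cleared t)" for t
  proof (induction t)
    case 0
    have "reachable G (Suc w) (mset_set {}, {})"
      unfolding reachable_def using execution.start by fastforce
    then have "reachable G (Suc w) (mset_set ({} \<union> bag 0), {})"
      using card_bag[of 0] bag_verts by (intro reachable_place_set) (auto simp: frontier_def)
    then show ?case
    proof (intro clear)
      show "e \<subseteq> bag 0" if "e \<in> cleared 0 - {}" for e
        using that edge[of e] interval by (auto simp: cleared_def bag_def)
    qed (auto simp: frontier_def)
  next
    case (Suc t)
    let ?A = "bag t \<inter> bag (Suc t)"
    have split: "?A \<union> (bag t - bag (Suc t)) = bag t" "?A \<union> (bag (Suc t) - bag t) = bag (Suc t)"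
      by blast+
    have "reachable G (Suc w) (mset_set ?A, cleared t)"
    proof (rule reachable_remove_set)
      show "reachable G (Suc w) (mset_set (?A \<union> (bag t - bag (Suc t))), cleared t)"
        unfolding split by (rule Suc.IH)
      show "card (?A \<union> (bag t - bag (Suc t))) \<le> Suc w"
        unfolding split by (rule card_bag)
    qed (use frontier_bag in auto)
    then have "reachable G (Suc w) (mset_set (?A \<union> (bag (Suc t) - bag t)), cleared t)"
    proof (rule reachable_place_set)
      show "card (?A \<union> (bag (Suc t) - bag t)) \<le> Suc w"
        unfolding split by (rule card_bag)
    qed (use frontier_bag bag_verts[of "Suc t"] in auto)
    then have "reachable G (Suc w) (mset_set (bag (Suc t)), cleared t)"
      unfolding split .
    then show ?case
    proof (intro clear)
      show "frontier G (cleared t) \<subseteq> bag (Suc t)" using frontier_bag by blast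
      show "cleared t \<subseteq> cleared (Suc t)" by (auto simp: cleared_def le_SucI)
      show "e \<subseteq> bag (Suc t)" if new: "e \<in> cleared (Suc t) - cleared t" for e
      proof
        fix x assume "x \<in> e"
        have e: "e \<in> edges G" "\<forall>v\<in>e. lo v \<le> Suc t" using new by (auto simp: cleared_def)
        obtain y where "y \<in> e" "t < lo y" using new by (auto simp: cleared_def not_le)
        then have "Suc t \<le> hi x" using later[OF e(1) \<open>x \<in> e\<close>] by fastforce
        then show "x \<in> bag (Suc t)"
          using e \<open>x \<in> e\<close> edge[OF e(1)] by (auto simp: bag_def)
      qed
    qed
  qed
  define N where "N = (\<Sum>v\<in>verts G. lo v)"
  have N: "lo v \<le> N" if "v \<in> verts G" for v
    unfolding N_def using fin that by (intro member_le_sum) auto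
  have "\<forall>v\<in>e. lo v \<le> N" if "e \<in> edges G" for e
    using edge[OF that] N by auto
  then have "cleared N = edges G"
    by (auto simp: cleared_def)
  then have "reachable G (Suc w) (mset_set (bag N), edges G)"
    using main[of N] by simp
  then show ?thesis
    unfolding searchable_def reachable_def by blast
qed

section \<open>An interval representation of the rook's graph\<close>

text \<open>
  Column \<open>j\<close> is treated at time \<open>column_time h j\<close>; time \<open>h\<close> is left free for switching the middle
  row.
\<close>

definition column_time :: "nat \<Rightarrow> nat \<Rightarrow> nat" where
  "column_time h j = (if j < h then j else Suc j)"

text \<open>
  Below \<open>h\<close> are the rows guarded before their column is treated, from \<open>m - h\<close> on the rows guarded
  afterwards. A row in between exists for odd \<open>m\<close> only; its cells are guarded between the treatment
  of their column and time \<open>h\<close>, when the whole row is guarded.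
\<close>

definition guard_start :: "nat \<Rightarrow> nat \<Rightarrow> nat \<times> nat \<Rightarrow> nat" where
  "guard_start m h = (\<lambda>(i, j).
     if i < h then 0 else if m - h \<le> i then column_time h j else min h (column_time h j))"

definition guard_end :: "nat \<Rightarrow> nat \<Rightarrow> nat \<Rightarrow> nat \<times> nat \<Rightarrow> nat" where
  "guard_end m n h = (\<lambda>(i, j).
     if i < h then column_time h j else if m - h \<le> i then n else max h (column_time h j))"

lemma guard_overlap:
  assumes "h \<le> n" "j < n" "j' < n" "i = i' \<or> j = j'"
  shows "guard_start m h (i, j) \<le> guard_end m n h (i', j')"
  using assms by (auto simp: guard_start_def guard_end_def column_time_def)

text \<open>
  A column is guarded both in the first \<open>h\<close> and in the last \<open>h\<close> rows only while it is being
  treated, and none is treated at time \<open>h\<close>, when the middle row takes \<open>n\<close> guards. Before time \<open>h\<close> the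
  middle row takes at most \<open>h\<close> guards, later at most \<open>n - h\<close>; both leave room for the \<open>h\<close>
  additional guards of the current column because \<open>h \<le> n - h\<close>.
\<close>

lemma guard_width:
  assumes "m \<le> n" and h: "h = m div 2"
  shows "card {v \<in> verts (rook m n). guard_start m h v \<le> t \<and> t \<le> guard_end m n h v}
    \<le> rook_width m n" (is "card ?V \<le> _")
proof -
  define A where "A = {j. j < n \<and> t \<le> column_time h j}"
  define B where "B = {j. j < n \<and> column_time h j \<le> t}"
  define C where "C = {j. j < n \<and> min h (column_time h j) \<le> t \<and> t \<le> max h (column_time h j)}"
  have fin [simp]: "finite A" "finite B" "finite C"
    by (auto simp: A_def B_def C_def)
  have "m - h - h = m mod 2" "m - (m - h) = h"
    using h by presburger+
  then have size: "card {h..<m - h} = m mod 2" "card {m - h..<m} = h"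
    by simp_all
  have "?V \<subseteq> {..<h} \<times> A \<union> {m - h..<m} \<times> B \<union> {h..<m - h} \<times> C"
    by (auto simp: verts_rook guard_start_def guard_end_def A_def B_def C_def split: if_splits)
  then have "card ?V \<le> card ({..<h} \<times> A \<union> {m - h..<m} \<times> B \<union> {h..<m - h} \<times> C)"
    by (intro card_mono) auto
  also have "\<dots> \<le> card ({..<h} \<times> A) + card ({m - h..<m} \<times> B) + card ({h..<m - h} \<times> C)"
    by (intro order_trans[OF card_Un_le] add_right_mono card_Un_le)
  also have "\<dots> = h * (card A + card B) + (m mod 2) * card C"
    using size by (simp add: card_cartesian_product add_mult_distrib2)
  finally have V: "card ?V \<le> h * (card A + card B) + (m mod 2) * card C" .
  have "A \<union> B = {..<n}" by (auto simp: A_def B_def)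
  then have AB: "card A + card B = n + card (A \<inter> B)"
    using card_Un_Int[of A B] by simp
  have row: "h * n + (m mod 2) * n \<le> rook_width m n"
    using h by (auto simp: rook_width_def odd_iff_mod_2_eq_one)
  show ?thesis
  proof (cases "t = h")
    case True
    have "A \<inter> B = {}"
      by (auto simp: A_def B_def column_time_def True split: if_splits)
    moreover have "card C \<le> n"
      using card_mono[of "{..<n}" C] by (auto simp: C_def)
    ultimately have "h * (card A + card B) + (m mod 2) * card C \<le> h * n + (m mod 2) * n"
      by (simp add: AB)
    with V row show ?thesis by linarith
  next
    case False
    have "A \<inter> B \<subseteq> {if t < h then t else t - 1}"
      by (auto simp: A_def B_def column_time_def split: if_splits)
    then have "card (A \<inter> B) \<le> 1"
      using card_mono[of "{if t < h then t else t - 1}" "A \<inter> B"] by simp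
    then have hAB: "h * (card A + card B) \<le> h * (n + 1)"
      unfolding AB by (intro mult_left_mono) auto
    have "C \<subseteq> (if t < h then {..<h} else {h..<n})"
      using False by (auto simp: C_def column_time_def split: if_splits)
    then have "card C \<le> (if t < h then h else n - h)"
      using card_mono[of "if t < h then {..<h} else {h..<n}" C] by (auto split: if_splits)
    then have "card C \<le> n - h" using assms by (auto split: if_splits)
    then have "(m mod 2) * card C \<le> (m mod 2) * (n - h)" by simp
    with V hAB have "card ?V \<le> h * (n + 1) + (m mod 2) * (n - h)" by linarith
    also have "\<dots> \<le> rook_width m n"
      using assms by (auto simp: rook_width_def odd_iff_mod_2_eq_one)
    finally show ?thesis .
  qed
qed

section \<open>The search number\<close>

lemma searchable_rook:
  assumes "m \<le> n"
  shows "searchable (rook m n) (Suc (rook_width m n))"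
proof (rule interval_representation_searchable)
  let ?h = "m div 2"
  have "?h \<le> n" using assms by linarith
  show "fin_simple_graph (rook m n)"
    by (intro fin_simple_cart_prod fin_simple_complete_graph)
  show "guard_start m ?h v \<le> guard_end m n ?h v" if "v \<in> verts (rook m n)" for v
    using that guard_overlap[OF \<open>?h \<le> n\<close>] by (cases v) (simp add: verts_rook)
  show "guard_start m ?h u \<le> guard_end m n ?h v" if "{u, v} \<in> edges (rook m n)" for u v
    using that guard_overlap[OF \<open>?h \<le> n\<close>] by (cases u, cases v) (auto simp: rook_adjacent_iff)
  show "card {v \<in> verts (rook m n). guard_start m ?h v \<le> t \<and> t \<le> guard_end m n ?h v}
      \<le> rook_width m n" for t
    using assms by (rule guard_width) simp
qed

lemma not_searchable_rook:
  assumes "2 \<le> m" "m \<le> n" "Suc k < rook_width m n"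
  shows "\<not> searchable (rook m n) k"
  using assms by (intro bramble_imp_not_searchable[OF bramble_rook] rook_bramble_avoids) auto

lemma search_number_rook:
  assumes "2 \<le> m" "m \<le> n"
  shows "rook_width m n \<le> Suc (search_number (rook m n))"
    and "search_number (rook m n) \<le> Suc (rook_width m n)"
proof -
  note searchable = searchable_rook[OF assms(2)]
  have "searchable (rook m n) (search_number (rook m n))"
    unfolding search_number_def using searchable by (rule LeastI)
  then show "rook_width m n \<le> Suc (search_number (rook m n))"
    using not_searchable_rook[OF assms] by (meson not_le)
  show "search_number (rook m n) \<le> Suc (rook_width m n)"
    unfolding search_number_def using searchable by (rule Least_le)
qed

theorem corollary16:
  fixes m n :: nat
  assumes "2 \<le> m" and "m \<le> n"
  shows "(even m \<longrightarrow>
            real m / 2 * real n + real m / 2 - 1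
              \<le> real (search_number (complete_graph m \<box> complete_graph n)) \<and>
            real (search_number (complete_graph m \<box> complete_graph n))
              \<le> real m / 2 * real n + real m / 2 + 1) \<and>
         (odd m \<longrightarrow>
            of_int \<lceil>real m / 2\<rceil> * real n - 1
              \<le> real (search_number (complete_graph m \<box> complete_graph n)) \<and>
            real (search_number (complete_graph m \<box> complete_graph n))
              \<le> of_int \<lceil>real m / 2\<rceil> * real n + 1)"
proof -
  let ?s = "search_number (complete_graph m \<box> complete_graph n)"
  have bounds: "real (rook_width m n) - 1 \<le> real ?s" "real ?s \<le> real (rook_width m n) + 1"
    using search_number_rook[OF assms] by linarith+
  have "real (rook_width m n) = real m / 2 * real n + real m / 2" if "even m"
    using that by (auto simp: rook_width_def elim!: evenE)
  moreover have "real (rook_width m n) = of_int \<lceil>real m / 2\<rceil> * real n" if "odd m"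
  proof -
    have "real m = 2 * real (m div 2) + 1" using that by (auto elim!: oddE)
    then have "\<lceil>real m / 2\<rceil> = int (m div 2) + 1"
      by (intro ceiling_unique) auto
    with that show ?thesis by (simp add: rook_width_def algebra_simps)
  qed
  ultimately show ?thesis using bounds by auto
qed

end
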